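(* For $i=1,\dots,K$ let $\theta^{(i)}>0$ and $\tau^{(i)}\neq0$ denote constants, and let $X^{(i)}$ be a $(\theta^{(i)},\tau^{(i)})$ GMSI process on $[0,\Delta)$, where $0<\Delta\le\min\{\theta^{(i)}/\tau^{(i)}:1\le i\le K,\ \tau^{(i)}>0\}$ if $\tau^{(i)}>0$ for some $i\in\{1,\dots,K\}$, and $0<\Delta\le\infty$ otherwise. Assume that the $X^{(i)}$ are independent of one another, and let $$X(t)=\sum_{i=1}^K k_iX^{(i)}(t),\quad 0\le t<\Delta,$$ where the $k_i$ are constants. Then $X$ is a $(\theta,\tau)$ GMSI process on $[0,\Delta)$, where $$\theta=\sum_{i=1}^Kk_i^2\theta^{(i)}>0\quad\text{and}\quad\tau=\sum_{i=1}^Kk_i^2\tau^{(i)}\le\frac{\theta}{\Delta}.$$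
   Context: A $(\theta,\tau)$ GMSI process on $[0,\Delta)$ (where $0<\Delta\le\infty$, $\theta>0$, $\tau\le\theta/\Delta$, with $\theta/\infty=0$) is a real, continuous, zero-mean Gaussian Markov process $X$ with $X(0)=0$, stationary increments, and covariance $E[X(s)X(t)]=s(\theta-\tau t)$ for $0\le s\le t<\Delta$.
   Formalization: The formal statement additionally assumes that at least one of the constants k_i is nonzero; if all k_i = 0 then θ = 0, so the claim θ > 0 fails. *)

theory Defs
  imports "HOL-Probability.Probability"
begin

text \<open>
  A process on \<open>[0, \<Delta>)\<close>, with \<open>\<Delta>\<close> possibly infinite, is a function \<open>X :: real \<Rightarrow> 'w \<Rightarrow> real\<close>. None of
  the notions below depends on its values at times outside \<open>time_set \<Delta>\<close>.
\<close>

definition time_set :: "ereal \<Rightarrow> real set" where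
  "time_set \<Delta> = {t. 0 \<le> t \<and> ereal t < \<Delta>}"

text \<open>The case of a constant is the normal law of variance zero, which \<open>normal_density\<close> excludes.\<close>

definition gaussian_rv :: "'w measure \<Rightarrow> ('w \<Rightarrow> real) \<Rightarrow> bool" where
  "gaussian_rv M Y \<longleftrightarrow> Y \<in> borel_measurable M \<and>
     ((\<exists>\<mu> \<sigma>. 0 < \<sigma> \<and> distributed M lborel Y (\<lambda>x. ennreal (normal_density \<mu> \<sigma> x))) \<or>
      (\<exists>\<mu>. AE \<omega> in M. Y \<omega> = \<mu>))"

definition gaussian_process :: "'w measure \<Rightarrow> real set \<Rightarrow> (real \<Rightarrow> 'w \<Rightarrow> real) \<Rightarrow> bool" where
  "gaussian_process M T X \<longleftrightarrow>
     (\<forall>S c. finite S \<and> S \<subseteq> T \<longrightarrow> gaussian_rv M (\<lambda>\<omega>. \<Sum>t\<in>S. c t * X t \<omega>))"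

text \<open>The sigma-algebra on \<open>space M\<close> generated by the variables \<open>X u\<close>, \<open>u \<in> U\<close>.\<close>

definition generated_algebra ::
    "'w measure \<Rightarrow> real set \<Rightarrow> (real \<Rightarrow> 'w \<Rightarrow> real) \<Rightarrow> 'w measure" where
  "generated_algebra M U X =
     sigma (space M) (\<Union>u\<in>U. {X u -` A \<inter> space M |A. A \<in> sets borel})"

definition markov_process :: "'w measure \<Rightarrow> real set \<Rightarrow> (real \<Rightarrow> 'w \<Rightarrow> real) \<Rightarrow> bool" where
  "markov_process M T X \<longleftrightarrow>
     (\<forall>t\<in>T. X t \<in> borel_measurable M) \<and>
     (\<forall>s\<in>T. \<forall>t\<in>T. \<forall>B\<in>sets borel. s \<le> t \<longrightarrow>
        (AE \<omega> in M.
           real_cond_exp M (generated_algebra M {u\<in>T. u \<le> s} X) (\<lambda>\<omega>. indicator B (X t \<omega>)) \<omega> =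
           real_cond_exp M (generated_algebra M {s} X) (\<lambda>\<omega>. indicator B (X t \<omega>)) \<omega>))"

definition stationary_increments :: "'w measure \<Rightarrow> real set \<Rightarrow> (real \<Rightarrow> 'w \<Rightarrow> real) \<Rightarrow> bool" where
  "stationary_increments M T X \<longleftrightarrow>
     (\<forall>s t h. s \<le> t \<and> s \<in> T \<and> t \<in> T \<and> s + h \<in> T \<and> t + h \<in> T \<longrightarrow>
        distr M borel (\<lambda>\<omega>. X (t + h) \<omega> - X (s + h) \<omega>) = distr M borel (\<lambda>\<omega>. X t \<omega> - X s \<omega>))"

text \<open>
  In \<open>ereal\<close>, a real divided by \<open>\<infinity>\<close> is \<open>0\<close>, so the bound on \<open>\<tau>\<close> reads \<open>\<tau> \<le> 0\<close> when \<open>\<Delta> = \<infinity>\<close>. Continuity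
  and \<open>X 0 = 0\<close> are understood almost surely. The integrals are not vacuous, since Gaussian variables
  have moments of all orders.
\<close>

definition gmsi_process ::
    "'w measure \<Rightarrow> ereal \<Rightarrow> real \<Rightarrow> real \<Rightarrow> (real \<Rightarrow> 'w \<Rightarrow> real) \<Rightarrow> bool" where
  "gmsi_process M \<Delta> \<theta> \<tau> X \<longleftrightarrow>
     prob_space M \<and>
     0 < \<Delta> \<and> 0 < \<theta> \<and> ereal \<tau> \<le> ereal \<theta> / \<Delta> \<and>
     (AE \<omega> in M. continuous_on (time_set \<Delta>) (\<lambda>t. X t \<omega>)) \<and>
     (AE \<omega> in M. X 0 \<omega> = 0) \<and>
     gaussian_process M (time_set \<Delta>) X \<and>
     markov_process M (time_set \<Delta>) X \<and>
     stationary_increments M (time_set \<Delta>) X \<and>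
     (\<forall>t\<in>time_set \<Delta>. integral\<^sup>L M (X t) = 0) \<and>
     (\<forall>s\<in>time_set \<Delta>. \<forall>t\<in>time_set \<Delta>. s \<le> t \<longrightarrow>
        integral\<^sup>L M (\<lambda>\<omega>. X s \<omega> * X t \<omega>) = s * (\<theta> - \<tau> * t))"

text \<open>
  Independence of a family of processes: each process is one random variable with values in the
  product space over the time set.
\<close>

definition indep_processes ::
    "'w measure \<Rightarrow> real set \<Rightarrow> ('i \<Rightarrow> real \<Rightarrow> 'w \<Rightarrow> real) \<Rightarrow> 'i set \<Rightarrow> bool" where
  "indep_processes M T X I \<longleftrightarrow>
     prob_space.indep_vars M (\<lambda>_. Pi\<^sub>M T (\<lambda>_. borel)) (\<lambda>i \<omega>. \<lambda>t\<in>T. X i t \<omega>) I"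

end

theory Submission
  imports Defs
begin

text \<open>
  For \<open>s \<le> t\<close> put \<open>\<alpha> = (\<theta> - \<tau> t) / (\<theta> - \<tau> s)\<close>. The covariance \<open>u (\<theta> - \<tau> t)\<close>, \<open>u \<le> t\<close>, makes
  \<open>R = X t - \<alpha> X s\<close> uncorrelated with every \<open>X u\<close>, \<open>u \<le> s\<close>; by Gaussianity \<open>R\<close> is independent of the
  past, so the conditional law of \<open>X t = \<alpha> X s + R\<close> given the past depends on \<open>X s\<close> only. Likewise
  \<open>X t - X s\<close> is centred normal with variance \<open>\<theta> (t - s) - \<tau> (t - s)\<^sup>2\<close>. Hence the Markov property and
  the stationarity of increments both follow from the covariance, and covariances of independent
  centred processes add up with weights \<open>(k i)\<^sup>2\<close>.
\<close>

section \<open>Independence from characteristic functions\<close>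

lemma (in prob_space) integrable_bounded_complex:
  fixes Z :: "'a \<Rightarrow> complex"
  assumes "Z \<in> borel_measurable M" "\<And>\<omega>. \<omega> \<in> space M \<Longrightarrow> norm (Z \<omega>) \<le> C"
  shows "integrable M Z"
  by (rule integrable_const_bound[of _ C]) (use assms in auto)

text \<open>
  After adding a constant to \<open>z\<close> and normalising, \<open>z\<close> becomes a probability density under which \<open>W\<close> has
  the same characteristic function as under \<open>M\<close>; Levy's uniqueness theorem then applies.
\<close>

lemma (in prob_space) integral_mult_indicator_eq_0_real:
  fixes z W :: "'a \<Rightarrow> real"
  assumes [measurable]: "z \<in> borel_measurable M" "W \<in> borel_measurable M" "B \<in> sets borel"
    and bound: "\<And>\<omega>. \<omega> \<in> space M \<Longrightarrow> \<bar>z \<omega>\<bar> \<le> C"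
    and zero: "\<And>a. (CLINT \<omega>|M. z \<omega> * iexp (a * W \<omega>)) = 0"
  shows "(\<integral>\<omega>. z \<omega> * indicator B (W \<omega>) \<partial>M) = 0"
proof -
  \<comment> \<open>Taking \<open>\<bar>C\<bar> + 1\<close> instead of \<open>C\<close> makes
    \<open>D\<close> strictly positive even when \<open>C = 0\<close>, so that it can serve as a
    divisor.\<close>
  define D where "D = \<bar>C\<bar> + 1"
  have D: "D > 0" by (simp add: D_def)
  have zD: "\<bar>z \<omega>\<bar> \<le> D" if "\<omega> \<in> space M" for \<omega>
    using bound[OF that] by (simp add: D_def)
  define p where "p \<omega> = (z \<omega> + D) / D" for \<omega>
  have [measurable]: "p \<in> borel_measurable M" unfolding p_def by measurable
  have p0: "0 \<le> p \<omega>" if "\<omega> \<in> space M" for \<omega>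
    using zD[OF that] D by (simp add: p_def)
  have AEp: "AE \<omega> in M. 0 \<le> p \<omega>" using p0 by (auto intro!: AE_I2)
  have iz: "integrable M z"
    by (rule integrable_const_bound[of _ D]) (use zD in auto)
  have ip: "integrable M p"
    unfolding p_def[abs_def] using iz by (intro integrable_divide integrable_add) auto
  \<comment> \<open>Frequency \<open>0\<close> of the hypothesis says that \<open>z\<close> has mean
    zero, which is why \<open>p\<close> integrates to \<open>1\<close>.\<close>
  have "(CLINT \<omega>|M. complex_of_real (z \<omega>)) = 0" using zero[of 0] by simp
  then have Ez: "(\<integral>\<omega>. z \<omega> \<partial>M) = 0" by simp
  have pz: "p \<omega> = 1 + z \<omega> / D" for \<omega> using D by (simp add: p_def field_simps)
  have "(\<integral>\<omega>. p \<omega> \<partial>M) = 1"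
    unfolding pz using iz Ez by (simp add: prob_space)
  then have "(\<integral>\<^sup>+ \<omega>. ennreal (p \<omega>) \<partial>M) = 1"
    by (subst nn_integral_eq_integral[OF ip AEp]) simp
  then have "emeasure (density M p) (space M) = 1"
    by (simp add: emeasure_density cong: nn_integral_cong)
  then interpret N: prob_space "density M p"
    by (intro prob_spaceI) simp
  have [measurable]: "W \<in> borel_measurable (density M p)" by simp
  have "char (distr (density M p) borel W) a = char (distr M borel W) a" for a
  proof -
    have i1: "integrable M (\<lambda>\<omega>. iexp (a * W \<omega>))"
      by (rule integrable_bounded_complex[of _ 1]) auto
    have i2: "integrable M (\<lambda>\<omega>. z \<omega> * iexp (a * W \<omega>))"
      by (rule integrable_bounded_complex[of _ D]) (use zD in \<open>auto simp: norm_mult\<close>)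
    have "char (distr (density M p) borel W) a = (CLINT \<omega>|M. p \<omega> *\<^sub>R iexp (a * W \<omega>))"
      unfolding char_def by (subst integral_distr, simp, simp, subst integral_density) (use AEp in auto)
    also have "\<dots> = (CLINT \<omega>|M. iexp (a * W \<omega>) + (z \<omega> * iexp (a * W \<omega>)) / D)"
      by (intro Bochner_Integration.integral_cong) (auto simp: pz scaleR_conv_of_real algebra_simps)
    also have "\<dots> = (CLINT \<omega>|M. iexp (a * W \<omega>))"
      using i1 i2 zero[of a] by simp
    finally show ?thesis unfolding char_def by (subst (2) integral_distr) auto
  qed
  then have "distr (density M p) borel W = distr M borel W"
    by (intro Levy_uniqueness real_distribution_distr N.real_distribution_distr) auto
  \<comment> \<open>Since \<open>p = 1 + z / D\<close>, the probabilities of \<open>B\<close> under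
    the two equal laws differ by the wanted integral divided by \<open>D\<close>.\<close>
  then have "(\<integral>x. indicator B x \<partial>distr (density M p) borel W) = (\<integral>x. indicator B x \<partial>distr M borel W :: real)"
    by simp
  moreover have "(\<integral>x. indicator B x \<partial>distr M borel W :: real) = (\<integral>\<omega>. indicator B (W \<omega>) \<partial>M)"
    by (rule integral_distr) auto
  moreover have "(\<integral>x. indicator B x \<partial>distr (density M p) borel W :: real)
      = (\<integral>\<omega>. p \<omega> *\<^sub>R (indicator B (W \<omega>) :: real) \<partial>M)"
    by (subst integral_distr, simp, simp, subst integral_density) (use AEp in auto)
  moreover have "(\<integral>\<omega>. p \<omega> *\<^sub>R (indicator B (W \<omega>) :: real) \<partial>M)
     = (\<integral>\<omega>. indicator B (W \<omega>) + (z \<omega> * indicator B (W \<omega>)) / D \<partial>M)"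
    by (intro Bochner_Integration.integral_cong) (auto simp: pz algebra_simps)
  moreover have "integrable M (\<lambda>\<omega>. indicator B (W \<omega>) :: real)"
    by (rule integrable_const_bound[of _ 1]) auto
  moreover have "integrable M (\<lambda>\<omega>. z \<omega> * indicator B (W \<omega>) :: real)"
    by (rule integrable_const_bound[of _ D]) (use zD D in \<open>auto split: split_indicator\<close>)
  ultimately show ?thesis using D by simp
qed

text \<open>Reduction to the real case. Conjugating the hypothesis at frequency \<open>-a\<close>
  gives it for \<open>cnj Z\<close> at frequency \<open>a\<close>; linear combinations of the two
  transfer it to the real and the imaginary part of \<open>Z\<close>.\<close>

lemma (in prob_space) integral_mult_indicator_eq_0:
  fixes Z :: "'a \<Rightarrow> complex" and W :: "'a \<Rightarrow> real"
  assumes [measurable]: "Z \<in> borel_measurable M" "W \<in> borel_measurable M" "B \<in> sets borel"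
    and bound: "\<And>\<omega>. \<omega> \<in> space M \<Longrightarrow> norm (Z \<omega>) \<le> C"
    and zero: "\<And>a. (CLINT \<omega>|M. Z \<omega> * iexp (a * W \<omega>)) = 0"
  shows "(CLINT \<omega>|M. Z \<omega> * indicator B (W \<omega>)) = 0"
proof -
  have iZ: "integrable M (\<lambda>\<omega>. Z \<omega> * iexp (a * W \<omega>))" for a
    by (rule integrable_bounded_complex[of _ C]) (use bound in \<open>auto simp: norm_mult\<close>)
  have icZ: "integrable M (\<lambda>\<omega>. cnj (Z \<omega>) * iexp (a * W \<omega>))" for a
    using integrable_cnj[OF iZ[of "-a"]] by (simp add: exp_cnj)
  have czero: "(CLINT \<omega>|M. cnj (Z \<omega>) * iexp (a * W \<omega>)) = 0" for a
  proof -
    have "(CLINT \<omega>|M. cnj (Z \<omega>) * iexp (a * W \<omega>)) = (CLINT \<omega>|M. cnj (Z \<omega> * iexp ((-a) * W \<omega>)))"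
      by (intro Bochner_Integration.integral_cong) (auto simp: exp_cnj)
    also have "\<dots> = cnj (CLINT \<omega>|M. Z \<omega> * iexp ((-a) * W \<omega>))"
      by (rule Bochner_Integration.integral_cnj)
    finally show ?thesis using zero[of "-a"] by simp
  qed
  have meas: "(\<lambda>\<omega>. Re (Z \<omega>)) \<in> borel_measurable M" "(\<lambda>\<omega>. Im (Z \<omega>)) \<in> borel_measurable M"
    using assms(1) by (simp_all add: borel_measurable_complex_iff)
  have re: "(\<integral>\<omega>. Re (Z \<omega>) * indicator B (W \<omega>) \<partial>M) = 0"
  proof (rule integral_mult_indicator_eq_0_real[where C=C, OF meas(1) assms(2,3)])
    fix a
    have "(CLINT \<omega>|M. complex_of_real (Re (Z \<omega>)) * iexp (a * W \<omega>))
      = (CLINT \<omega>|M. (Z \<omega> * iexp (a * W \<omega>) + cnj (Z \<omega>) * iexp (a * W \<omega>)) / 2)"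
      by (intro Bochner_Integration.integral_cong)
        (auto simp: distrib_right[symmetric] complex_add_cnj)
    also have "\<dots> = 0" using iZ icZ zero czero by simp
    finally show "(CLINT \<omega>|M. complex_of_real (Re (Z \<omega>)) * iexp (a * W \<omega>)) = 0" .
  next
    show "\<bar>Re (Z \<omega>)\<bar> \<le> C" if "\<omega> \<in> space M" for \<omega>
      by (rule order_trans[OF abs_Re_le_cmod bound[OF that]])
  qed
  have im: "(\<integral>\<omega>. Im (Z \<omega>) * indicator B (W \<omega>) \<partial>M) = 0"
  proof (rule integral_mult_indicator_eq_0_real[where C=C, OF meas(2) assms(2,3)])
    fix a
    have eq: "complex_of_real (Im x) * e = (x * e - cnj x * e) / (2 * \<i>)" for x e
    proof -
      have "x * e - cnj x * e = (x - cnj x) * e" by (rule left_diff_distrib[symmetric])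
      also have "\<dots> = complex_of_real (2 * Im x) * \<i> * e" by (simp only: complex_diff_cnj)
      finally show ?thesis
        by (subst nonzero_eq_divide_eq) (simp, simp only: of_real_mult of_real_numeral mult_ac)
    qed
    have "(CLINT \<omega>|M. complex_of_real (Im (Z \<omega>)) * iexp (a * W \<omega>))
      = (CLINT \<omega>|M. (Z \<omega> * iexp (a * W \<omega>) - cnj (Z \<omega>) * iexp (a * W \<omega>)) / (2 * \<i>))"
      by (simp only: eq)
    also have "\<dots> = 0" using iZ icZ zero czero by simp
    finally show "(CLINT \<omega>|M. complex_of_real (Im (Z \<omega>)) * iexp (a * W \<omega>)) = 0" .
  next
    show "\<bar>Im (Z \<omega>)\<bar> \<le> C" if "\<omega> \<in> space M" for \<omega>
      by (rule order_trans[OF abs_Im_le_cmod bound[OF that]])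
  qed
  have i: "integrable M (\<lambda>\<omega>. Z \<omega> * indicator B (W \<omega>))"
    by (rule integrable_bounded_complex[of _ C])
      (auto simp: norm_mult bound order_trans[OF norm_ge_zero bound] split: split_indicator)
  have ind: "Re (x * indicator B y) = Re x * indicator B y" "Im (x * indicator B y) = Im x * indicator B y"
    for x y by (auto split: split_indicator)
  show ?thesis
  proof (rule complex_eqI)
    show "Re (CLINT \<omega>|M. Z \<omega> * indicator B (W \<omega>)) = Re 0"
      unfolding integral_Re[OF i, symmetric] ind using re by simp
    show "Im (CLINT \<omega>|M. Z \<omega> * indicator B (W \<omega>)) = Im 0"
      unfolding integral_Im[OF i, symmetric] ind using im by simp
  qed
qed

text \<open>Exponentials are traded for indicators one coordinate at a time. Each indicator obtained
  is absorbed into the bounded factor \<open>Z\<close>, so the induction has to generalise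
  \<open>Z\<close>.\<close>

lemma (in prob_space) integral_mult_prod_indicator_eq_0:
  fixes Z :: "'a \<Rightarrow> complex" and W :: "'t \<Rightarrow> 'a \<Rightarrow> real"
  assumes "finite S" "Z \<in> borel_measurable M" "\<And>t. t \<in> S \<Longrightarrow> W t \<in> borel_measurable M"
    and "\<And>t. t \<in> S \<Longrightarrow> B t \<in> sets borel"
    and "\<And>\<omega>. \<omega> \<in> space M \<Longrightarrow> norm (Z \<omega>) \<le> C"
    and "\<And>c. (CLINT \<omega>|M. Z \<omega> * iexp (\<Sum>t\<in>S. c t * W t \<omega>)) = 0"
  shows "(CLINT \<omega>|M. Z \<omega> * (\<Prod>t\<in>S. indicator (B t) (W t \<omega>))) = 0"
  using assms
proof (induction S arbitrary: Z rule: finite_induct)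
  case empty
  from empty(5) show ?case by simp
next
  case (insert t S)
  note [measurable] = insert.prems(1)
  have [measurable]: "\<And>t. t \<in> S \<Longrightarrow> W t \<in> borel_measurable M" "W t \<in> borel_measurable M"
    "B t \<in> sets borel" using insert.prems by auto
  have "(CLINT \<omega>|M. (Z \<omega> * indicator (B t) (W t \<omega>)) * (\<Prod>t\<in>S. indicator (B t) (W t \<omega>))) = 0"
  proof (rule insert.IH)
    fix c
    have "(CLINT \<omega>|M. (Z \<omega> * iexp (\<Sum>t\<in>S. c t * W t \<omega>)) * indicator (B t) (W t \<omega>)) = 0"
    proof (rule integral_mult_indicator_eq_0[where C=C])
      fix a
      show "(CLINT \<omega>|M. Z \<omega> * iexp (\<Sum>t\<in>S. c t * W t \<omega>) * iexp (a * W t \<omega>)) = 0"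
      proof -
        \<comment> \<open>The hypothesis covers all coefficient vectors, so the frequency
          \<open>a\<close> at \<open>t\<close> can vary while those on \<open>S\<close> stay
          fixed.\<close>
        have "(\<Sum>u\<in>insert t S. (c(t := a)) u * W u \<omega>) = (\<Sum>u\<in>S. c u * W u \<omega>) + a * W t \<omega>" for \<omega>
          using insert.hyps by (auto intro!: sum.cong)
        then show ?thesis using insert.prems(5)[of "c(t := a)"]
          by (simp add: exp_add[symmetric] ring_distribs mult.assoc del: fun_upd_apply)
      qed
    qed (use insert.prems(4) in \<open>auto simp: norm_mult\<close>)
    then show "(CLINT \<omega>|M. (Z \<omega> * indicator (B t) (W t \<omega>)) * iexp (\<Sum>t\<in>S. c t * W t \<omega>)) = 0"
      by (simp add: mult_ac)
  next
    show "norm (Z \<omega> * indicator (B t) (W t \<omega>)) \<le> C" if "\<omega> \<in> space M" for \<omega>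
      using insert.prems(4)[OF that] by (auto simp: norm_mult split: split_indicator intro: order_trans[OF norm_ge_zero])
  qed (use insert.prems in auto)
  then show ?case using insert.hyps by (simp add: mult_ac)
qed

section \<open>Generated sigma-algebras and their cylinder sets\<close>

lemma space_generated_algebra [simp]: "space (generated_algebra M U W) = space M"
  unfolding generated_algebra_def by (rule space_measure_of) auto

lemma sets_generated_algebra:
  "sets (generated_algebra M U W)
    = sigma_sets (space M) (\<Union>u\<in>U. {W u -` A \<inter> space M |A. A \<in> sets borel})"
  unfolding generated_algebra_def by (rule sets_measure_of) auto

lemma measurable_generated_algebra:
  "u \<in> U \<Longrightarrow> W u \<in> borel_measurable (generated_algebra M U W)"
  by (rule measurableI) (auto simp: sets_generated_algebra)

lemma subalgebra_generated_algebra: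
  assumes "\<And>u. u \<in> U \<Longrightarrow> W u \<in> borel_measurable M"
  shows "subalgebra M (generated_algebra M U W)"
  unfolding subalgebra_def sets_generated_algebra
  by (auto intro!: sets.sigma_sets_subset measurable_sets[OF assms])

text \<open>A pi-system that generates the sigma-algebra of the family. Each member constrains
  finitely many coordinates, so information on finite linear combinations suffices to handle
  it.\<close>

definition cylinder_sets :: "'a measure \<Rightarrow> 't set \<Rightarrow> ('t \<Rightarrow> 'a \<Rightarrow> real) \<Rightarrow> 'a set set" where
  "cylinder_sets M U W =
    {{\<omega>\<in>space M. \<forall>t\<in>S. W t \<omega> \<in> B t} |S B. finite S \<and> S \<subseteq> U \<and> (\<forall>t\<in>S. B t \<in> sets borel)}"

lemma Int_stable_cylinder_sets: "Int_stable (cylinder_sets M U W)"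
proof (rule Int_stableI)
  fix a b assume "a \<in> cylinder_sets M U W" "b \<in> cylinder_sets M U W"
  then obtain S B S' B' where
    a: "a = {\<omega>\<in>space M. \<forall>t\<in>S. W t \<omega> \<in> B t}" "finite S" "S \<subseteq> U" "\<forall>t\<in>S. B t \<in> sets borel" and
    b: "b = {\<omega>\<in>space M. \<forall>t\<in>S'. W t \<omega> \<in> B' t}" "finite S'" "S' \<subseteq> U" "\<forall>t\<in>S'. B' t \<in> sets borel"
    unfolding cylinder_sets_def by blast
  \<comment> \<open>A coordinate missing from \<open>S\<close> or \<open>S'\<close> is padded with
    \<open>UNIV\<close>, so that both cylinders live over \<open>S \<union> S'\<close>.\<close>
  define C where "C t = (if t \<in> S then B t else UNIV) \<inter> (if t \<in> S' then B' t else UNIV)" for t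
  have "a \<inter> b = {\<omega>\<in>space M. \<forall>t\<in>S \<union> S'. W t \<omega> \<in> C t}"
    by (auto simp: a b C_def)
  moreover have "\<forall>t\<in>S \<union> S'. C t \<in> sets borel" using a b by (auto simp: C_def)
  ultimately show "a \<inter> b \<in> cylinder_sets M U W"
    unfolding cylinder_sets_def using a(2,3) b(2,3)
    by (intro CollectI exI[of _ "S \<union> S'"] exI[of _ C] conjI finite_UnI Un_least)
qed

lemma generated_algebra_subset_cylinder_sets:
  "sets (generated_algebra M U W) \<subseteq> sigma_sets (space M) (cylinder_sets M U W)"
  unfolding sets_generated_algebra
proof (rule sigma_sets_mono', safe)
  fix u A assume "u \<in> U" "A \<in> sets (borel :: real measure)"
  then show "W u -` A \<inter> space M \<in> cylinder_sets M U W"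
    unfolding cylinder_sets_def by (intro CollectI exI[of _ "{u}"] exI[of _ "\<lambda>_. A"]) auto
qed

text \<open>Two passes of the trade between exponentials and indicators. The first replaces the
  exponentials of the \<open>W t\<close> by the indicator of a cylinder, the second replaces the
  exponential of \<open>R\<close> by an indicator. Independence on these two pi-systems extends to
  the sigma-algebras.\<close>

lemma (in prob_space) indep_set_generated_algebra:
  fixes R :: "'a \<Rightarrow> real" and W :: "real \<Rightarrow> 'a \<Rightarrow> real"
  assumes R [measurable]: "R \<in> borel_measurable M"
    and W: "\<And>u. u \<in> U \<Longrightarrow> W u \<in> borel_measurable M"
    and fac: "\<And>S a c. finite S \<Longrightarrow> S \<subseteq> U \<Longrightarrow>
      (CLINT \<omega>|M. iexp (a * R \<omega> + (\<Sum>t\<in>S. c t * W t \<omega>)))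
        = (CLINT \<omega>|M. iexp (a * R \<omega>)) * (CLINT \<omega>|M. iexp (\<Sum>t\<in>S. c t * W t \<omega>))"
  shows "indep_set (sigma_sets (space M) {R -` A \<inter> space M |A. A \<in> sets borel})
    (sets (generated_algebra M U W))"
proof -
  have "indep_set {R -` A \<inter> space M |A. A \<in> sets borel} (cylinder_sets M U W)"
  proof (unfold indep_sets2_eq, intro conjI ballI)
    show "{R -` A \<inter> space M |A. A \<in> sets borel} \<subseteq> events" by auto
    show sub: "cylinder_sets M U W \<subseteq> events"
    proof
      fix A assume "A \<in> cylinder_sets M U W"
      then obtain S B where A: "A = {\<omega>\<in>space M. \<forall>t\<in>S. W t \<omega> \<in> B t}" "finite S" "S \<subseteq> U"
        and B: "\<forall>t\<in>S. B t \<in> sets borel"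
        unfolding cylinder_sets_def by blast
      have "{\<omega> \<in> space M. W t \<omega> \<in> B t} \<in> sets M" if "t \<in> S" for t
        using measurable_sets[OF W[of t], of "B t"] that A B by (auto simp: vimage_def Int_def conj_commute)
      then show "A \<in> events" unfolding A
        by (intro sets.sets_Collect_finite_All) (use A in auto)
    qed
    fix D A assume "D \<in> {R -` A \<inter> space M |A. A \<in> sets borel}" and A_in: "A \<in> cylinder_sets M U W"
    then obtain C where C: "D = R -` C \<inter> space M" and [measurable]: "C \<in> sets borel" by auto
    obtain S B where A: "A = {\<omega>\<in>space M. \<forall>t\<in>S. W t \<omega> \<in> B t}" "finite S" "S \<subseteq> U"
      and B: "\<And>t. t \<in> S \<Longrightarrow> B t \<in> sets borel"
      using A_in unfolding cylinder_sets_def by blast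
    have [measurable]: "A \<in> sets M" using A_in sub by auto
    have WS [measurable]: "t \<in> S \<Longrightarrow> W t \<in> borel_measurable M" for t using W A by auto
    have ind: "(indicator A \<omega> :: complex) = (\<Prod>t\<in>S. indicator (B t) (W t \<omega>))" if "\<omega> \<in> space M" for \<omega>
      using that A by (auto simp: indicator_def prod_zero_iff)
    have ie: "integrable M (\<lambda>\<omega>. iexp (f \<omega>))" if [measurable]: "f \<in> borel_measurable M" for f
      by (rule integrable_bounded_complex[of _ 1]) auto
    have iA: "integrable M (\<lambda>\<omega>. iexp (f \<omega>) * indicator A \<omega>)" if [measurable]: "f \<in> borel_measurable M" for f
      by (rule integrable_bounded_complex[of _ 1]) (auto simp: norm_mult split: split_indicator)
    have cind: "(CLINT \<omega>|M. indicator D \<omega>) = complex_of_real (prob D)" if "D \<in> sets M" for D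
    proof -
      have "(CLINT \<omega>|M. indicator D \<omega>) = (CLINT \<omega>|M. complex_of_real (indicator D \<omega>))"
        by (intro Bochner_Integration.integral_cong) (auto split: split_indicator)
      then show ?thesis using that by simp
    qed
    have 1: "(CLINT \<omega>|M. iexp (a * R \<omega>) * indicator A \<omega>) = (CLINT \<omega>|M. iexp (a * R \<omega>)) * prob A" for a
    proof -
      \<comment> \<open>Centring \<open>iexp (a * R \<omega>)\<close> at its mean turns the
        factorisation \<open>fac\<close> into the vanishing of an integral against every exponential
        of the \<open>W t\<close>.\<close>
      define m where "m = (CLINT \<omega>|M. iexp (a * R \<omega>))"
      have "(CLINT \<omega>|M. (iexp (a * R \<omega>) - m) * (\<Prod>t\<in>S. indicator (B t) (W t \<omega>))) = 0"
      proof (rule integral_mult_prod_indicator_eq_0[where C="1 + norm m"])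
        show "norm (iexp (a * R \<omega>) - m) \<le> 1 + norm m" for \<omega>
          using norm_triangle_ineq4[of "iexp (a * R \<omega>)" m] by simp
        fix c
        have i1: "integrable M (\<lambda>\<omega>. iexp (a * R \<omega> + (\<Sum>t\<in>S. c t * W t \<omega>)))"
          by (rule ie) measurable
        have i2: "integrable M (\<lambda>\<omega>. m * iexp (\<Sum>t\<in>S. c t * W t \<omega>))"
          by (intro integrable_mult_right ie) measurable
        have "(CLINT \<omega>|M. (iexp (a * R \<omega>) - m) * iexp (\<Sum>t\<in>S. c t * W t \<omega>))
          = (CLINT \<omega>|M. iexp (a * R \<omega> + (\<Sum>t\<in>S. c t * W t \<omega>)) - m * iexp (\<Sum>t\<in>S. c t * W t \<omega>))"
          by (intro Bochner_Integration.integral_cong) (auto simp: algebra_simps exp_add)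
        also have "\<dots> = (CLINT \<omega>|M. iexp (a * R \<omega> + (\<Sum>t\<in>S. c t * W t \<omega>)))
            - m * (CLINT \<omega>|M. iexp (\<Sum>t\<in>S. c t * W t \<omega>))"
          by (subst Bochner_Integration.integral_diff[OF i1 i2]) simp
        also have "\<dots> = 0" using fac[OF A(2,3)] by (simp add: m_def)
        finally show "(CLINT \<omega>|M. (iexp (a * R \<omega>) - m) * iexp (\<Sum>t\<in>S. c t * W t \<omega>)) = 0" .
      qed (use A B WS in auto)
      also have "(CLINT \<omega>|M. (iexp (a * R \<omega>) - m) * (\<Prod>t\<in>S. indicator (B t) (W t \<omega>)))
          = (CLINT \<omega>|M. iexp (a * R \<omega>) * indicator A \<omega> - m * indicator A \<omega>)"
        by (intro Bochner_Integration.integral_cong) (auto simp: ind algebra_simps)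
      also have "\<dots> = (CLINT \<omega>|M. iexp (a * R \<omega>) * indicator A \<omega>) - m * prob A"
        by (subst Bochner_Integration.integral_diff)
          (auto intro!: iA integrable_mult_right integrable_bounded_complex[of _ 1]
            simp: cind split: split_indicator)
      finally show ?thesis by (simp add: m_def)
    qed
    \<comment> \<open>Roles are now exchanged: the centred indicator of the cylinder
      \<open>A\<close> is the bounded factor, and \<open>1\<close> says that it is orthogonal to all
      exponentials of \<open>R\<close>.\<close>
    have "(\<integral>\<omega>. (indicator A \<omega> - prob A) * indicator C (R \<omega>) \<partial>M) = 0"
    proof (rule integral_mult_indicator_eq_0_real[where C=1])
      show "\<bar>indicator A \<omega> - prob A\<bar> \<le> 1" for \<omega>
        by (auto split: split_indicator)
      fix a
      have j1: "integrable M (\<lambda>\<omega>. iexp (a * R \<omega>) * indicator A \<omega>)"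
        by (rule iA) measurable
      have j2: "integrable M (\<lambda>\<omega>. complex_of_real (prob A) * iexp (a * R \<omega>))"
        by (intro integrable_mult_right ie) measurable
      have "(CLINT \<omega>|M. complex_of_real (indicator A \<omega> - prob A) * iexp (a * R \<omega>))
        = (CLINT \<omega>|M. iexp (a * R \<omega>) * indicator A \<omega> - prob A * iexp (a * R \<omega>))"
        by (intro Bochner_Integration.integral_cong) (auto simp: algebra_simps split: split_indicator)
      also have "\<dots> = (CLINT \<omega>|M. iexp (a * R \<omega>) * indicator A \<omega>) - prob A * (CLINT \<omega>|M. iexp (a * R \<omega>))"
        by (subst Bochner_Integration.integral_diff[OF j1 j2]) simp
      finally show "(CLINT \<omega>|M. complex_of_real (indicator A \<omega> - prob A) * iexp (a * R \<omega>)) = 0"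
        using 1[of a] by simp
    qed measurable
    also have "(\<integral>\<omega>. (indicator A \<omega> - prob A) * indicator C (R \<omega>) \<partial>M)
        = (\<integral>\<omega>. indicator (D \<inter> A) \<omega> - prob A * indicator D \<omega> \<partial>M)"
      unfolding C by (intro Bochner_Integration.integral_cong) (auto split: split_indicator)
    also have "\<dots> = prob (D \<inter> A) - prob A * prob D"
    proof -
      have "integrable M (indicator (D \<inter> A) :: _ \<Rightarrow> real)" "integrable M (\<lambda>\<omega>. prob A * indicator D \<omega>)"
        unfolding C by (auto intro!: integrable_real_indicator integrable_mult_right simp: emeasure_eq_measure)
      then show ?thesis
        unfolding C by (subst Bochner_Integration.integral_diff) auto
    qed
    finally show "prob (D \<inter> A) = prob D * prob A" by simp
  qed
  then have "indep_set (sigma_sets (space M) {R -` A \<inter> space M |A. A \<in> sets borel})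
      (sigma_sets (space M) (cylinder_sets M U W))"
  proof (rule indep_set_sigma_sets)
    show "Int_stable {R -` A \<inter> space M |A. A \<in> sets borel}"
      by (rule Int_stableI, clarsimp, rule_tac x="A \<inter> Aa" in exI) auto
  qed (rule Int_stable_cylinder_sets)
  then show ?thesis
    using generated_algebra_subset_cylinder_sets unfolding indep_sets2_eq by blast
qed

section \<open>Conditional expectation with an independent summand\<close>

text \<open>Given \<open>F\<close>, the variable \<open>V\<close> is frozen and the independent
  \<open>R\<close> is integrated out. This is Fubini for the joint law of \<open>R\<close> and the
  point \<open>\<omega>\<close> seen through \<open>F\<close>.\<close>

lemma (in prob_space) real_cond_exp_indep_add:
  fixes R V :: "'a \<Rightarrow> real"
  assumes F: "subalgebra M F"
    and R [measurable]: "R \<in> borel_measurable M" and V [measurable]: "V \<in> borel_measurable F"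
    and indep: "indep_set (sigma_sets (space M) {R -` A \<inter> space M |A. A \<in> sets borel}) (sets F)"
    and B [measurable]: "B \<in> sets borel"
  shows "AE \<omega> in M. real_cond_exp M F (\<lambda>\<omega>. indicator B (V \<omega> + R \<omega>)) \<omega>
    = (\<integral>r. indicator B (V \<omega> + r) \<partial>distr M borel R)"
proof -
  interpret F: finite_measure_subalgebra M F by unfold_locales (rule F)
  interpret R: prob_space "distr M borel R" by (rule prob_space_distr) simp
  have spF: "space F = space M" using F by (simp add: subalgebra_def)
  \<comment> \<open>As a map from \<open>M\<close> to \<open>F\<close>, the identity is a random
    element generating \<open>F\<close>. Independence of \<open>R\<close> from \<open>F\<close>
    thereby becomes the product form of the law of \<open>(R \<omega>, \<omega>)\<close>.\<close>
  have idF [measurable]: "(\<lambda>\<omega>. \<omega>) \<in> measurable M F"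
    using F by (auto simp: subalgebra_def measurable_def)
  interpret MF: prob_space "distr M F (\<lambda>\<omega>. \<omega>)" by (rule prob_space_distr) simp
  interpret P: pair_prob_space "distr M borel R" "distr M F (\<lambda>\<omega>. \<omega>)" by standard
  have joint: "distr M borel R \<Otimes>\<^sub>M distr M F (\<lambda>\<omega>. \<omega>) = distr M (borel \<Otimes>\<^sub>M F) (\<lambda>\<omega>. (R \<omega>, \<omega>))"
  proof (rule pair_measure_eqI)
    show "sigma_finite_measure (distr M borel R)" "sigma_finite_measure (distr M F (\<lambda>\<omega>. \<omega>))"
      by unfold_locales
    show "sets (distr M borel R \<Otimes>\<^sub>M distr M F (\<lambda>\<omega>. \<omega>)) = sets (distr M (borel \<Otimes>\<^sub>M F) (\<lambda>\<omega>. (R \<omega>, \<omega>)))"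
      by (simp cong: sets_pair_measure_cong)
    fix C A assume "C \<in> sets (distr M borel R)" "A \<in> sets (distr M F (\<lambda>\<omega>. \<omega>))"
    then have [measurable]: "C \<in> sets borel" and A [measurable]: "A \<in> sets F" by auto
    have AM: "A \<subseteq> space M" using sets.sets_into_space[OF A] spF by simp
    have "prob ((R -` C \<inter> space M) \<inter> A) = prob (R -` C \<inter> space M) * prob A"
      by (rule indep_setD[OF indep]) (auto intro!: sigma_sets.Basic)
    moreover have "(R -` C \<inter> space M) \<inter> A = (\<lambda>\<omega>. (R \<omega>, \<omega>)) -` (C \<times> A) \<inter> space M"
      "(\<lambda>\<omega>. \<omega>) -` A \<inter> space M = A" using AM by auto
    ultimately show "emeasure (distr M borel R) C * emeasure (distr M F (\<lambda>\<omega>. \<omega>)) A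
        = emeasure (distr M (borel \<Otimes>\<^sub>M F) (\<lambda>\<omega>. (R \<omega>, \<omega>))) (C \<times> A)"
      by (simp add: emeasure_distr emeasure_eq_measure ennreal_mult'[symmetric])
  qed
  have [measurable]: "V \<in> borel_measurable M" using measurable_from_subalg[OF F V] .
  define g where "g \<omega> = (\<integral>r. indicator B (V \<omega> + r) \<partial>distr M borel R :: real)" for \<omega>
  have gF [measurable]: "g \<in> borel_measurable F"
    unfolding g_def[abs_def] by (rule R.borel_measurable_lebesgue_integral) measurable
  have gM [measurable]: "g \<in> borel_measurable M" using measurable_from_subalg[OF F gF] .
  show ?thesis
    unfolding g_def[symmetric]
  proof (rule F.real_cond_exp_charact)
    fix A assume A [measurable]: "A \<in> sets F"
    \<comment> \<open>The test set \<open>A\<close> is made part of the integrand, so that the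
      integral over \<open>A\<close> is one integral against the product law and the inner integral
      over \<open>r\<close> produces \<open>g\<close>.\<close>
    define f where "f = (\<lambda>(r, \<omega>). indicator A \<omega> * indicator B (V \<omega> + r) :: real)"
    have fm [measurable]: "f \<in> borel_measurable (borel \<Otimes>\<^sub>M F)" unfolding f_def by measurable
    have "(\<integral>\<omega>\<in>A. indicator B (V \<omega> + R \<omega>) \<partial>M) = (\<integral>\<omega>. f (R \<omega>, \<omega>) \<partial>M)"
      by (simp add: set_lebesgue_integral_def f_def)
    also have "\<dots> = (\<integral>p. f p \<partial>distr M (borel \<Otimes>\<^sub>M F) (\<lambda>\<omega>. (R \<omega>, \<omega>)))"
      by (rule integral_distr[symmetric]) auto
    also have "\<dots> = (\<integral>p. f p \<partial>(distr M borel R \<Otimes>\<^sub>M distr M F (\<lambda>\<omega>. \<omega>)))"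
      by (simp add: joint)
    also have "\<dots> = (\<integral>\<omega>. (\<integral>r. f (r, \<omega>) \<partial>distr M borel R) \<partial>distr M F (\<lambda>\<omega>. \<omega>))"
      by (subst P.integral_snd) (auto intro!: P.integrable_const_bound[of _ 1] simp: f_def split: split_indicator)
    also have "\<dots> = (\<integral>\<omega>. indicator A \<omega> * g \<omega> \<partial>distr M F (\<lambda>\<omega>. \<omega>))"
      by (simp add: f_def g_def)
    also have "\<dots> = (\<integral>\<omega>\<in>A. g \<omega> \<partial>M)"
      by (subst integral_distr) (auto simp: set_lebesgue_integral_def)
    finally show "(\<integral>\<omega>\<in>A. indicator B (V \<omega> + R \<omega>) \<partial>M) = (\<integral>\<omega>\<in>A. g \<omega> \<partial>M)" .
  next
    show "integrable M (\<lambda>\<omega>. indicator B (V \<omega> + R \<omega>) :: real)"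
      by (rule integrable_const_bound[of _ 1]) auto
    have "norm (g \<omega>) \<le> 1" for \<omega>
    proof -
      have "g \<omega> = (\<integral>r. indicator {r. V \<omega> + r \<in> B} r \<partial>distr M borel R)"
        unfolding g_def by (simp add: indicator_def)
      then show ?thesis by (simp add: R.prob_le_1)
    qed
    then show "integrable M g"
      by (intro integrable_const_bound[of _ 1]) auto
  qed simp
qed

section \<open>Centred Gaussian variables\<close>

lemma char_distr:
  "W \<in> borel_measurable M \<Longrightarrow> char (distr M borel W) a = (CLINT \<omega>|M. iexp (a * W \<omega>))"
  unfolding char_def by (rule integral_distr) auto

text \<open>Standardising \<open>L\<close> reduces this to the characteristic function of the
  standard normal law.\<close>

lemma (in prob_space) char_normal:
  assumes "0 < \<sigma>" and D: "distributed M lborel L (\<lambda>x. ennreal (normal_density \<mu> \<sigma> x))"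
  shows "(CLINT \<omega>|M. iexp (a * L \<omega>)) = iexp (a * \<mu>) * exp (- (a\<^sup>2 * \<sigma>\<^sup>2 / 2))"
proof -
  have [measurable]: "L \<in> borel_measurable M" using distributed_measurable[OF D] by simp
  define Z where "Z = (\<lambda>\<omega>. (L \<omega> - \<mu>) / \<sigma>)"
  have [measurable]: "Z \<in> borel_measurable M" unfolding Z_def by measurable
  have "distributed M lborel Z std_normal_density"
    using D assms(1) normal_standard_normal_convert unfolding Z_def by blast
  then have "distr M borel Z = std_normal_distribution"
    by (metis distributed_distr_eq_density distr_cong sets_lborel)
  then have "(CLINT \<omega>|M. iexp (t * Z \<omega>)) = exp (- (t\<^sup>2) / 2)" for t
    using char_distr[of Z M t] by (simp add: char_std_normal_distribution)
  from this[of "a * \<sigma>"] have "(CLINT \<omega>|M. iexp (a * \<sigma> * Z \<omega>)) = exp (- (a\<^sup>2 * \<sigma>\<^sup>2 / 2))"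
    by (simp add: power_mult_distrib)
  moreover have "(CLINT \<omega>|M. iexp (a * L \<omega>)) = (CLINT \<omega>|M. iexp (a * \<mu>) * iexp (a * \<sigma> * Z \<omega>))"
  proof (intro Bochner_Integration.integral_cong refl)
    fix \<omega>
    have "a * L \<omega> = a * \<mu> + a * \<sigma> * Z \<omega>" using assms(1) by (simp add: Z_def field_simps)
    then show "iexp (a * L \<omega>) = iexp (a * \<mu>) * iexp (a * \<sigma> * Z \<omega>)"
      by (simp only: exp_add[symmetric] distrib_left[symmetric] of_real_add)
  qed
  ultimately show ?thesis by simp
qed

lemma (in prob_space) gaussian_rv_integrable:
  assumes "gaussian_rv M L"
  shows "integrable M L" "integrable M (\<lambda>\<omega>. (L \<omega>)\<^sup>2)"
proof -
  have [measurable]: "L \<in> borel_measurable M" using assms by (simp add: gaussian_rv_def)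
  have "integrable M L \<and> integrable M (\<lambda>\<omega>. (L \<omega>)\<^sup>2)"
    using assms unfolding gaussian_rv_def
  proof (elim conjE disjE exE)
    fix \<mu> \<sigma> :: real assume \<sigma>: "0 < \<sigma>"
      and D: "distributed M lborel L (\<lambda>x. ennreal (normal_density \<mu> \<sigma> x))"
    \<comment> \<open>The expansion \<open>x\<^sup>2 = (x - \<mu>)\<^sup>2 + 2 * \<mu> * x -
      \<mu>\<^sup>2\<close> reduces the second moment to the central one, the first moment and the
      total mass.\<close>
    have "integrable lborel (\<lambda>x. normal_density \<mu> \<sigma> x * (x - \<mu>)\<^sup>2 + 2 * \<mu> * (normal_density \<mu> \<sigma> x * x) - \<mu>\<^sup>2 * normal_density \<mu> \<sigma> x)"
      using \<sigma> by (intro Bochner_Integration.integrable_add Bochner_Integration.integrable_diff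
          integrable_mult_right integrable_normal_moment integrable_normal_moment_nz_1 integrable_normal_density)
    then have "integrable lborel (\<lambda>x. normal_density \<mu> \<sigma> x * x\<^sup>2)"
      by (rule back_subst) (auto simp: fun_eq_iff algebra_simps power2_eq_square)
    then show ?thesis
      using distributed_integrable[OF D, of "\<lambda>x. x"] distributed_integrable[OF D, of "\<lambda>x. x\<^sup>2"]
        integrable_normal_moment_nz_1[OF \<sigma>] by auto
  next
    fix \<mu> assume "AE \<omega> in M. L \<omega> = \<mu>"
    then have "AE \<omega> in M. norm (L \<omega>) \<le> \<bar>\<mu>\<bar>" "AE \<omega> in M. norm ((L \<omega>)\<^sup>2) \<le> \<mu>\<^sup>2" by auto
    then show ?thesis by (intro conjI integrable_const_bound) auto
  qed
  then show "integrable M L" "integrable M (\<lambda>\<omega>. (L \<omega>)\<^sup>2)" by auto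
qed

text \<open>Treats the normal and the constant case of \<open>gaussian_rv\<close> by one formula: a
  centred constant vanishes almost surely, so its second moment is \<open>0\<close> and both sides
  are \<open>1\<close>. Later arguments need no case distinction.\<close>

lemma (in prob_space) char_gaussian_rv:
  assumes "gaussian_rv M L" and mean: "expectation L = 0"
  shows "(CLINT \<omega>|M. iexp (a * L \<omega>)) = exp (- (a\<^sup>2 * expectation (\<lambda>\<omega>. (L \<omega>)\<^sup>2) / 2))"
  using assms(1) unfolding gaussian_rv_def
proof (elim conjE disjE exE)
  fix \<mu> \<sigma> :: real assume \<sigma>: "0 < \<sigma>"
    and D: "distributed M lborel L (\<lambda>x. ennreal (normal_density \<mu> \<sigma> x))"
  have "\<mu> = 0" using normal_distributed_expectation[OF \<sigma> D] mean by simp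
  moreover have "\<sigma>\<^sup>2 = expectation (\<lambda>\<omega>. (L \<omega>)\<^sup>2)"
    using normal_distributed_variance[OF \<sigma> D] mean by simp
  ultimately show ?thesis using char_normal[OF \<sigma> D] by simp
next
  fix \<mu> assume [measurable]: "L \<in> borel_measurable M" and AE: "AE \<omega> in M. L \<omega> = \<mu>"
  have "expectation L = \<mu>" using AE by (subst integral_cong_AE[of _ _ "\<lambda>_. \<mu>"]) (auto simp: prob_space)
  then have 0: "AE \<omega> in M. L \<omega> = 0" using AE mean by simp
  then have "expectation (\<lambda>\<omega>. (L \<omega>)\<^sup>2) = 0" by (intro integral_eq_zero_AE) auto
  moreover have "(CLINT \<omega>|M. iexp (a * L \<omega>)) = (CLINT \<omega>|M. 1)"
    using 0 by (intro integral_cong_AE) auto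
  ultimately show ?thesis by (simp add: prob_space)
qed

text \<open>Converse of the preceding formula, by Levy uniqueness. For \<open>v = 0\<close> the
  comparison law is the point mass at \<open>0\<close>, which leads to the constant case of
  \<open>gaussian_rv\<close>.\<close>

lemma (in prob_space) gaussian_rvI_char:
  assumes [measurable]: "L \<in> borel_measurable M" and "0 \<le> v"
    and ch: "\<And>a. (CLINT \<omega>|M. iexp (a * L \<omega>)) = exp (- (a\<^sup>2 * v / 2))"
  shows "gaussian_rv M L"
proof (cases "v = 0")
  case False
  define \<sigma> where "\<sigma> = sqrt v"
  have \<sigma>: "0 < \<sigma>" "\<sigma>\<^sup>2 = v" using False assms(2) by (auto simp: \<sigma>_def)
  interpret N: prob_space "density lborel (normal_density 0 \<sigma>)"
    by (rule prob_space_normal_density[OF \<sigma>(1)])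
  \<comment> \<open>The comparison variable is the identity on the normal law itself, so that
    \<open>char_normal\<close> applies there.\<close>
  have D: "distributed (density lborel (normal_density 0 \<sigma>)) lborel (\<lambda>x. x) (normal_density 0 \<sigma>)"
    by (auto simp: distributed_def distr_id2)
  have "distr M borel L = distr (density lborel (normal_density 0 \<sigma>)) borel (\<lambda>x. x)"
  proof (rule Levy_uniqueness)
    show "real_distribution (distr M borel L)" by (rule real_distribution_distr) simp
    show "real_distribution (distr (density lborel (normal_density 0 \<sigma>)) borel (\<lambda>x. x))"
      by (rule N.real_distribution_distr) simp
    show "char (distr M borel L) = char (distr (density lborel (normal_density 0 \<sigma>)) borel (\<lambda>x. x))"
    proof
      fix a
      show "char (distr M borel L) a = char (distr (density lborel (normal_density 0 \<sigma>)) borel (\<lambda>x. x)) a"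
        using N.char_normal[OF \<sigma>(1) D, of a] ch[of a]
        by (subst (1 2) char_distr) (simp_all add: \<sigma>(2))
    qed
  qed
  also have "\<dots> = density lborel (normal_density 0 \<sigma>)" by (simp add: distr_id2)
  finally have "distributed M lborel L (\<lambda>x. ennreal (normal_density 0 \<sigma> x))"
    by (simp add: distributed_def cong: distr_cong)
  then show ?thesis using \<sigma>(1) unfolding gaussian_rv_def by auto
next
  case True
  interpret N: prob_space "return borel (0::real)" by (rule prob_space_return) simp
  have "distr M borel L = distr (return borel (0::real)) borel (\<lambda>x. x)"
  proof (rule Levy_uniqueness)
    show "real_distribution (distr M borel L)" by (rule real_distribution_distr) simp
    show "real_distribution (distr (return borel (0::real)) borel (\<lambda>x. x))"
      by (rule N.real_distribution_distr) simp
    show "char (distr M borel L) = char (distr (return borel (0::real)) borel (\<lambda>x. x))"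
    proof
      fix a
      show "char (distr M borel L) a = char (distr (return borel (0::real)) borel (\<lambda>x. x)) a"
        using ch[of a] True by (subst (1 2) char_distr) (simp_all add: integral_return)
    qed
  qed
  \<comment> \<open>Evaluating the equal laws at the atom \<open>{0}\<close> turns equality in law
    into \<open>L = 0\<close> almost surely.\<close>
  then have "emeasure (distr M borel L) {0} = emeasure (distr (return borel (0::real)) borel (\<lambda>x. x)) {0}"
    by simp
  then have "prob {\<omega>\<in>space M. L \<omega> = 0} = 1"
    by (simp add: emeasure_distr emeasure_eq_measure vimage_def Int_def conj_commute)
  then have "AE \<omega> in M. L \<omega> = 0" by (subst (asm) prob_Collect_eq_1) auto
  then show ?thesis unfolding gaussian_rv_def by auto
qed

section \<open>Gaussian processes with GMSI covariance\<close>

lemma integrable_mult_of_squares: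
  fixes f g :: "'a \<Rightarrow> real"
  assumes [measurable]: "f \<in> borel_measurable M" "g \<in> borel_measurable M"
    and "integrable M (\<lambda>x. (f x)\<^sup>2)" "integrable M (\<lambda>x. (g x)\<^sup>2)"
  shows "integrable M (\<lambda>x. f x * g x)"
proof (rule Bochner_Integration.integrable_bound[of M "\<lambda>x. (f x)\<^sup>2 + (g x)\<^sup>2"])
  have "\<bar>a * b\<bar> \<le> a\<^sup>2 + b\<^sup>2" for a b :: real
  proof -
    have "2 * \<bar>a * b\<bar> \<le> a\<^sup>2 + b\<^sup>2"
      using sum_squares_bound[of "\<bar>a\<bar>" "\<bar>b\<bar>"] by (simp add: abs_mult mult.assoc)
    then show ?thesis using abs_ge_zero[of "a * b"] by linarith
  qed
  then show "AE x in M. norm (f x * g x) \<le> norm ((f x)\<^sup>2 + (g x)\<^sup>2)" by (auto intro!: AE_I2)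
qed (use assms in auto)

lemma gaussian_process_comb:
  assumes "gaussian_process M T X" "finite S" "S \<subseteq> T" "s \<in> T" "t \<in> T"
  shows "gaussian_rv M (\<lambda>\<omega>. a * X t \<omega> + b * X s \<omega> + (\<Sum>u\<in>S. c u * X u \<omega>))"
proof -
  \<comment> \<open>The times \<open>s\<close> and \<open>t\<close> may coincide or lie in
    \<open>S\<close>, while \<open>gaussian_process\<close> takes one coefficient per time;
    \<open>d\<close> adds up the contributions that fall on the same time.\<close>
  define d where "d u = (if u = t then a else 0) + (if u = s then b else 0) + (if u \<in> S then c u else 0)" for u
  let ?S = "insert s (insert t S)"
  have "(\<Sum>u\<in>?S. d u * X u \<omega>) = a * X t \<omega> + b * X s \<omega> + (\<Sum>u\<in>S. c u * X u \<omega>)" for \<omega>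
  proof -
    have "d u * X u \<omega> = (if u = t then a * X u \<omega> else 0) + (if u = s then b * X u \<omega> else 0)
        + (if u \<in> S then c u * X u \<omega> else 0)" for u by (simp add: d_def algebra_simps)
    moreover have "(\<Sum>u\<in>?S. if u \<in> S then c u * X u \<omega> else 0) = (\<Sum>u\<in>S. c u * X u \<omega>)"
      using assms(2) by (intro sum.mono_neutral_cong_right) auto
    ultimately show ?thesis
      using assms(2) by (simp only: sum.distrib) (simp add: sum.delta)
  qed
  moreover have "gaussian_rv M (\<lambda>\<omega>. \<Sum>u\<in>?S. d u * X u \<omega>)"
    using assms unfolding gaussian_process_def by simp
  ultimately show ?thesis by simp
qed

lemma gaussian_process_rv:
  assumes "gaussian_process M T X" "t \<in> T"
  shows "gaussian_rv M (X t)"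
  using gaussian_process_comb[OF assms(1), of "{}" t t 1 0] assms(2) by simp

text \<open>Strictness comes from \<open>t < \<Delta>\<close>: if \<open>\<tau> > 0\<close>, then
  \<Delta> is finite and \<open>\<tau> * t < \<tau> * \<Delta> \<le> \<theta>\<close>; otherwise
  \<open>\<tau> * t \<le> 0 < \<theta>\<close>. It makes the denominator of the regression
  coefficient \<alpha> nonzero.\<close>

lemma gmsi_coefficient_pos:
  assumes "0 < \<theta>" "ereal \<tau> \<le> ereal \<theta> / \<Delta>" "t \<in> time_set \<Delta>"
  shows "0 < \<theta> - \<tau> * t"
proof (cases "0 < \<tau>")
  case False
  then have "\<tau> * t \<le> 0" using assms(3) by (simp add: time_set_def mult_nonpos_nonneg)
  then show ?thesis using assms(1) by simp
next
  case True
  show ?thesis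
  proof (cases \<Delta>)
    case (real d)
    then have d: "0 \<le> t" "t < d" using assms(3) by (auto simp: time_set_def)
    then have "\<tau> \<le> \<theta> / d" using assms(2) real by simp
    then have "\<tau> * d \<le> \<theta>" using d by (simp add: field_simps)
    moreover have "\<tau> * t < \<tau> * d" using d True by simp
    ultimately show ?thesis by simp
  next
    case PInf
    then show ?thesis using assms(2) True by simp
  next
    case MInf
    then show ?thesis using assms(3) by (simp add: time_set_def)
  qed
qed

text \<open>The Gaussian and covariance data from which the Markov property and stationarity are
  derived. The components satisfy it by assumption; the sum enters it once its own covariance is
  known.\<close>

locale gmsi_covariance = prob_space M for M :: "'w measure" +
  fixes \<Delta> :: ereal and \<theta> \<tau> :: real and X :: "real \<Rightarrow> 'w \<Rightarrow> real"
  assumes theta: "0 < \<theta>" and tau: "ereal \<tau> \<le> ereal \<theta> / \<Delta>"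
    and gaussian: "gaussian_process M (time_set \<Delta>) X"
    and mean: "\<And>t. t \<in> time_set \<Delta> \<Longrightarrow> expectation (X t) = 0"
    and cov: "\<And>s t. s \<in> time_set \<Delta> \<Longrightarrow> t \<in> time_set \<Delta> \<Longrightarrow> s \<le> t \<Longrightarrow>
      expectation (\<lambda>\<omega>. X s \<omega> * X t \<omega>) = s * (\<theta> - \<tau> * t)"
begin

lemma random_variable_X: "t \<in> time_set \<Delta> \<Longrightarrow> X t \<in> borel_measurable M"
  using gaussian_process_rv[OF gaussian] by (simp add: gaussian_rv_def)

lemma integrable_X: "t \<in> time_set \<Delta> \<Longrightarrow> integrable M (X t)"
  by (rule gaussian_rv_integrable gaussian_process_rv[OF gaussian])+

lemma integrable_X_mult:
  "s \<in> time_set \<Delta> \<Longrightarrow> t \<in> time_set \<Delta> \<Longrightarrow> integrable M (\<lambda>\<omega>. X s \<omega> * X t \<omega>)"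
  by (intro integrable_mult_of_squares random_variable_X gaussian_rv_integrable(2)
      gaussian_process_rv[OF gaussian])

text \<open>The terms at \<open>s\<close> and \<open>t\<close> stand apart from the sum over
  \<open>S\<close> so that the same formula covers residuals, increments, and a residual plus a
  combination of past values.\<close>

lemma char_X_comb:
  fixes a b :: real and c :: "real \<Rightarrow> real"
  assumes "finite S" "S \<subseteq> time_set \<Delta>" "s \<in> time_set \<Delta>" "t \<in> time_set \<Delta>"
  defines "L \<equiv> (\<lambda>\<omega>. a * X t \<omega> + b * X s \<omega> + (\<Sum>u\<in>S. c u * X u \<omega>))"
  shows "(CLINT \<omega>|M. iexp (L \<omega>)) = exp (- (expectation (\<lambda>\<omega>. (L \<omega>)\<^sup>2) / 2))"
proof -
  have "gaussian_rv M L" unfolding L_def by (rule gaussian_process_comb[OF gaussian assms(1-4)])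
  moreover have "expectation L = 0"
  proof -
    have "expectation L = a * expectation (X t) + b * expectation (X s) + (\<Sum>u\<in>S. c u * expectation (X u))"
    proof -
      have iS: "integrable M (\<lambda>\<omega>. c u * X u \<omega>)" if "u \<in> S" for u
        using that assms(2) integrable_X by auto
      show ?thesis
        unfolding L_def using iS integrable_X[OF assms(3)] integrable_X[OF assms(4)] by simp
    qed
    also have "\<dots> = 0" using mean assms(2-4) by (simp add: subset_iff)
    finally show ?thesis .
  qed
  ultimately show ?thesis using char_gaussian_rv[of L 1] by simp
qed

text \<open>\<open>U\<close> is left general in order to allow conditioning both on the whole past
  up to \<open>s\<close> and on the single time \<open>s\<close>.\<close>

lemma indep_residual:
  assumes s: "s \<in> time_set \<Delta>" and t: "t \<in> time_set \<Delta>" and "s \<le> t"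
    and U: "U \<subseteq> {u \<in> time_set \<Delta>. u \<le> s}"
  defines "\<alpha> \<equiv> (\<theta> - \<tau> * t) / (\<theta> - \<tau> * s)"
  shows "indep_set (sigma_sets (space M) {(\<lambda>\<omega>. X t \<omega> - \<alpha> * X s \<omega>) -` A \<inter> space M |A. A \<in> sets borel})
    (sets (generated_algebra M U X))"
proof (rule indep_set_generated_algebra)
  note [measurable] = random_variable_X[OF s] random_variable_X[OF t]
  show "(\<lambda>\<omega>. X t \<omega> - \<alpha> * X s \<omega>) \<in> borel_measurable M" by measurable
  show "X u \<in> borel_measurable M" if "u \<in> U" for u using that U random_variable_X by auto
  fix S a and c :: "real \<Rightarrow> real" assume S: "finite S" "S \<subseteq> U"
  then have ST: "S \<subseteq> time_set \<Delta>" using U by auto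
  define R where "R = (\<lambda>\<omega>. X t \<omega> - \<alpha> * X s \<omega>)"
  define L where "L = (\<lambda>\<omega>. \<Sum>u\<in>S. c u * X u \<omega>)"
  have iR: "integrable M (\<lambda>\<omega>. X u \<omega> * R \<omega>)" and ER: "expectation (\<lambda>\<omega>. X u \<omega> * R \<omega>) = 0" if "u \<in> S" for u
  proof -
    have u: "u \<in> time_set \<Delta>" "u \<le> s" using that S U by auto
    have "integrable M (\<lambda>\<omega>. X u \<omega> * X t \<omega> - \<alpha> * (X u \<omega> * X s \<omega>))"
      using integrable_X_mult u s t by auto
    then show "integrable M (\<lambda>\<omega>. X u \<omega> * R \<omega>)" by (simp add: R_def algebra_simps)
    have "expectation (\<lambda>\<omega>. X u \<omega> * R \<omega>) = expectation (\<lambda>\<omega>. X u \<omega> * X t \<omega> - \<alpha> * (X u \<omega> * X s \<omega>))"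
      by (simp add: R_def algebra_simps)
    also have "\<dots> = u * (\<theta> - \<tau> * t) - \<alpha> * (u * (\<theta> - \<tau> * s))"
      using u s t \<open>s \<le> t\<close> cov integrable_X_mult by simp
    \<comment> \<open>This cancellation is what fixes \<alpha>. It is the same for every
      \<open>u \<le> s\<close>, because the covariance is a product of a factor in \<open>u\<close>
      and a factor in the later time.\<close>
    also have "\<dots> = 0" using gmsi_coefficient_pos[OF theta tau s] by (simp add: \<alpha>_def)
    finally show "expectation (\<lambda>\<omega>. X u \<omega> * R \<omega>) = 0" .
  qed
  have "gaussian_rv M R" unfolding R_def
    using gaussian_process_comb[OF gaussian _ _ s t, of "{}" 1 "-\<alpha>"] by simp
  then have iR2: "integrable M (\<lambda>\<omega>. (R \<omega>)\<^sup>2)" by (rule gaussian_rv_integrable)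
  have "gaussian_rv M L" unfolding L_def using gaussian S ST unfolding gaussian_process_def by blast
  then have iL2: "integrable M (\<lambda>\<omega>. (L \<omega>)\<^sup>2)" by (rule gaussian_rv_integrable)
  have LR: "L \<omega> * R \<omega> = (\<Sum>u\<in>S. c u * (X u \<omega> * R \<omega>))" for \<omega>
    by (simp add: L_def sum_distrib_right mult.assoc)
  have iLR: "integrable M (\<lambda>\<omega>. L \<omega> * R \<omega>)" unfolding LR using iR by auto
  have ELR: "expectation (\<lambda>\<omega>. L \<omega> * R \<omega>) = 0"
    unfolding LR using iR ER by (subst Bochner_Integration.integral_sum) auto
  \<comment> \<open>Orthogonality of \<open>L\<close> and \<open>R\<close> removes the cross term,
    so the variance is additive and the Gaussian characteristic function factorises.\<close>
  have "expectation (\<lambda>\<omega>. (a * R \<omega> + L \<omega>)\<^sup>2)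
      = expectation (\<lambda>\<omega>. a\<^sup>2 * (R \<omega>)\<^sup>2 + 2 * a * (L \<omega> * R \<omega>) + (L \<omega>)\<^sup>2)"
    by (simp add: power2_eq_square algebra_simps)
  also have "\<dots> = a\<^sup>2 * expectation (\<lambda>\<omega>. (R \<omega>)\<^sup>2) + expectation (\<lambda>\<omega>. (L \<omega>)\<^sup>2)"
    using iR2 iL2 iLR ELR by simp
  finally have var: "expectation (\<lambda>\<omega>. (a * R \<omega> + L \<omega>)\<^sup>2)
      = a\<^sup>2 * expectation (\<lambda>\<omega>. (R \<omega>)\<^sup>2) + expectation (\<lambda>\<omega>. (L \<omega>)\<^sup>2)" .
  have cRL: "(CLINT \<omega>|M. iexp (a * R \<omega> + L \<omega>)) = exp (- (expectation (\<lambda>\<omega>. (a * R \<omega> + L \<omega>)\<^sup>2) / 2))"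
    using char_X_comb[OF S(1) ST s t, of a "- a * \<alpha>" c] by (simp add: R_def L_def algebra_simps)
  have cR: "(CLINT \<omega>|M. iexp (a * R \<omega>)) = exp (- (expectation (\<lambda>\<omega>. (a * R \<omega>)\<^sup>2) / 2))"
    using char_X_comb[of "{}" s t a "- a * \<alpha>" c] s t by (simp add: R_def algebra_simps)
  have cL: "(CLINT \<omega>|M. iexp (L \<omega>)) = exp (- (expectation (\<lambda>\<omega>. (L \<omega>)\<^sup>2) / 2))"
    using char_X_comb[OF S(1) ST s t, of 0 0 c] by (simp add: L_def)
  have "(CLINT \<omega>|M. iexp (a * R \<omega> + L \<omega>)) = (CLINT \<omega>|M. iexp (a * R \<omega>)) * (CLINT \<omega>|M. iexp (L \<omega>))"
    unfolding cRL cR cL var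
    by (simp add: power_mult_distrib add_divide_distrib flip: exp_add of_real_mult)
  then show "(CLINT \<omega>|M. iexp (a * (X t \<omega> - \<alpha> * X s \<omega>) + (\<Sum>u\<in>S. c u * X u \<omega>)))
      = (CLINT \<omega>|M. iexp (a * (X t \<omega> - \<alpha> * X s \<omega>))) * (CLINT \<omega>|M. iexp (\<Sum>u\<in>S. c u * X u \<omega>))"
    by (simp only: R_def L_def)
qed

lemma markov: "markov_process M (time_set \<Delta>) X"
  unfolding markov_process_def
proof (intro conjI ballI impI)
  fix s t and B :: "real set" assume s: "s \<in> time_set \<Delta>" and t: "t \<in> time_set \<Delta>"
    and B: "B \<in> sets borel" and st: "s \<le> t"
  define \<alpha> where "\<alpha> = (\<theta> - \<tau> * t) / (\<theta> - \<tau> * s)"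
  note [measurable] = random_variable_X[OF s] random_variable_X[OF t]
  \<comment> \<open>The right-hand side does not involve \<open>U\<close>. Applied to the past up to
    \<open>s\<close> and to \<open>{s}\<close>, it identifies the two conditional
    expectations.\<close>
  have "AE \<omega> in M. real_cond_exp M (generated_algebra M U X) (\<lambda>\<omega>. indicator B (X t \<omega>)) \<omega>
      = (\<integral>r. indicator B (\<alpha> * X s \<omega> + r) \<partial>distr M borel (\<lambda>\<omega>. X t \<omega> - \<alpha> * X s \<omega>))"
    if U: "U \<subseteq> {u \<in> time_set \<Delta>. u \<le> s}" "s \<in> U" for U
  proof -
    have sub: "subalgebra M (generated_algebra M U X)"
      by (rule subalgebra_generated_algebra) (use U random_variable_X in auto)
    have "(\<lambda>\<omega>. \<alpha> * X s \<omega>) \<in> borel_measurable (generated_algebra M U X)"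
      by (intro borel_measurable_times borel_measurable_const measurable_generated_algebra U)
    from real_cond_exp_indep_add[OF sub _ this indep_residual[OF s t st U(1), folded \<alpha>_def] B]
    show ?thesis by simp
  qed
  from this[of "{u \<in> time_set \<Delta>. u \<le> s}"] this[of "{s}"]
  show "AE \<omega> in M. real_cond_exp M (generated_algebra M {u \<in> time_set \<Delta>. u \<le> s} X) (\<lambda>\<omega>. indicator B (X t \<omega>)) \<omega>
      = real_cond_exp M (generated_algebra M {s} X) (\<lambda>\<omega>. indicator B (X t \<omega>)) \<omega>"
    using s by auto
qed (rule random_variable_X)

lemma stationary: "stationary_increments M (time_set \<Delta>) X"
  unfolding stationary_increments_def
proof (intro allI impI, elim conjE)
  have var: "expectation (\<lambda>\<omega>. (X t \<omega> - X s \<omega>)\<^sup>2) = \<theta> * (t - s) - \<tau> * (t - s)\<^sup>2"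
    if "s \<le> t" "s \<in> time_set \<Delta>" "t \<in> time_set \<Delta>" for s t
  proof -
    have "expectation (\<lambda>\<omega>. (X t \<omega> - X s \<omega>)\<^sup>2)
        = expectation (\<lambda>\<omega>. X t \<omega> * X t \<omega> - 2 * (X s \<omega> * X t \<omega>) + X s \<omega> * X s \<omega>)"
      by (simp add: power2_eq_square algebra_simps)
    also have "\<dots> = t * (\<theta> - \<tau> * t) - 2 * (s * (\<theta> - \<tau> * t)) + s * (\<theta> - \<tau> * s)"
      using that cov integrable_X_mult by simp
    finally show ?thesis by (simp add: power2_eq_square algebra_simps)
  qed
  have ch: "(CLINT \<omega>|M. iexp (a * (X t \<omega> - X s \<omega>))) = exp (- (a\<^sup>2 * (\<theta> * (t - s) - \<tau> * (t - s)\<^sup>2) / 2))"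
    if "s \<le> t" "s \<in> time_set \<Delta>" "t \<in> time_set \<Delta>" for s t a
  proof -
    have "expectation (\<lambda>\<omega>. (a * X t \<omega> + - a * X s \<omega>)\<^sup>2) = a\<^sup>2 * expectation (\<lambda>\<omega>. (X t \<omega> - X s \<omega>)\<^sup>2)"
      by (simp add: power_mult_distrib flip: right_diff_distrib)
    then show ?thesis
      using char_X_comb[of "{}" s t a "- a"] that var[OF that] by (simp add: right_diff_distrib)
  qed
  fix s t h assume 1: "s \<le> t" "s \<in> time_set \<Delta>" "t \<in> time_set \<Delta>"
    and 2: "s + h \<in> time_set \<Delta>" "t + h \<in> time_set \<Delta>"
  note [measurable] = 1(2,3)[THEN random_variable_X] 2[THEN random_variable_X]
  show "distr M borel (\<lambda>\<omega>. X (t + h) \<omega> - X (s + h) \<omega>) = distr M borel (\<lambda>\<omega>. X t \<omega> - X s \<omega>)"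
  proof (intro Levy_uniqueness real_distribution_distr ext)
    fix a
    \<comment> \<open>Both increments have lag \<open>t - s\<close>, and the characteristic function
      given by \<open>ch\<close> depends on the lag alone.\<close>
    show "char (distr M borel (\<lambda>\<omega>. X (t + h) \<omega> - X (s + h) \<omega>)) a = char (distr M borel (\<lambda>\<omega>. X t \<omega> - X s \<omega>)) a"
      using ch[OF 1, of a] ch[OF _ 2, of a] 1(1) by (subst (1 2) char_distr) simp_all
  qed measurable
qed

end

section \<open>Sums of independent processes\<close>

text \<open>Lets the Gaussian property pass to \<open>Y\<close>, which equals the weighted sum on
  \<open>space M\<close> only.\<close>

lemma gaussian_rv_cong:
  assumes "\<And>\<omega>. \<omega> \<in> space M \<Longrightarrow> f \<omega> = g \<omega>"
  shows "gaussian_rv M f \<longleftrightarrow> gaussian_rv M g"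
  using assms unfolding gaussian_rv_def distributed_def
  by (simp cong: measurable_cong distr_cong AE_cong)

text \<open>Characteristic functions of independent variables multiply, so the exponents, and with
  them the variances, add up; the product again has the form that identifies a centred
  Gaussian.\<close>

lemma (in prob_space) gaussian_rv_indep_sum:
  assumes "finite I" and indep: "indep_vars (\<lambda>_. borel) L I"
    and gaussian: "\<And>i. i \<in> I \<Longrightarrow> gaussian_rv M (L i)"
    and mean: "\<And>i. i \<in> I \<Longrightarrow> expectation (L i) = 0"
  shows "gaussian_rv M (\<lambda>\<omega>. \<Sum>i\<in>I. L i \<omega>)"
proof (rule gaussian_rvI_char)
  have [measurable]: "i \<in> I \<Longrightarrow> L i \<in> borel_measurable M" for i
    using gaussian by (simp add: gaussian_rv_def)
  show sum_meas: "(\<lambda>\<omega>. \<Sum>i\<in>I. L i \<omega>) \<in> borel_measurable M" by measurable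
  show "0 \<le> (\<Sum>i\<in>I. expectation (\<lambda>\<omega>. (L i \<omega>)\<^sup>2))" by (simp add: sum_nonneg)
  fix a
  have "(CLINT \<omega>|M. iexp (a * (\<Sum>i\<in>I. L i \<omega>))) = char (distr M borel (\<lambda>\<omega>. \<Sum>i\<in>I. L i \<omega>)) a"
    by (rule char_distr[OF sum_meas, symmetric])
  also have "\<dots> = (\<Prod>i\<in>I. char (distr M borel (L i)) a)"
    by (rule char_distr_sum[OF indep])
  also have "\<dots> = (\<Prod>i\<in>I. complex_of_real (exp (- (a\<^sup>2 * expectation (\<lambda>\<omega>. (L i \<omega>)\<^sup>2) / 2))))"
    using char_gaussian_rv[OF gaussian mean] by (intro prod.cong) (simp_all add: char_distr)
  also have "\<dots> = exp (- (a\<^sup>2 * (\<Sum>i\<in>I. expectation (\<lambda>\<omega>. (L i \<omega>)\<^sup>2)) / 2))"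
    using assms(1)
    by (simp only: of_real_prod[symmetric] exp_sum[symmetric])
      (simp add: sum_negf sum_divide_distrib sum_distrib_left)
  finally show "(CLINT \<omega>|M. iexp (a * (\<Sum>i\<in>I. L i \<omega>)))
      = exp (- (a\<^sup>2 * (\<Sum>i\<in>I. expectation (\<lambda>\<omega>. (L i \<omega>)\<^sup>2)) / 2))" .
qed

text \<open>Some \<open>k i\<close> is assumed nonzero, since otherwise the sum is zero and so is
  its \<theta>. \<open>Y\<close> is tied to the sum only at times in
  \<open>time_set \<Delta>\<close> and at points of \<open>space M\<close>.\<close>

theorem proposition1:
  fixes M :: "'w measure"
    and K :: nat
    and \<theta> \<tau> k :: "nat \<Rightarrow> real"
    and \<Delta> :: ereal
    and X :: "nat \<Rightarrow> real \<Rightarrow> 'w \<Rightarrow> real"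
    and Y :: "real \<Rightarrow> 'w \<Rightarrow> real"
  assumes "prob_space M"
    and "\<And>i. i \<in> {1..K} \<Longrightarrow> 0 < \<theta> i"
    and "\<And>i. i \<in> {1..K} \<Longrightarrow> \<tau> i \<noteq> 0"
    and "0 < \<Delta>"
    and "\<exists>i\<in>{1..K}. 0 < \<tau> i \<Longrightarrow> \<Delta> \<le> ereal (Min {\<theta> i / \<tau> i |i. i \<in> {1..K} \<and> 0 < \<tau> i})"
    and "\<And>i. i \<in> {1..K} \<Longrightarrow> gmsi_process M \<Delta> (\<theta> i) (\<tau> i) (X i)"
    and "indep_processes M (time_set \<Delta>) X {1..K}"
    and "\<exists>i\<in>{1..K}. k i \<noteq> 0"
    and "\<And>t \<omega>. t \<in> time_set \<Delta> \<Longrightarrow> \<omega> \<in> space M \<Longrightarrow> Y t \<omega> = (\<Sum>i=1..K. k i * X i t \<omega>)"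
  shows "gmsi_process M \<Delta> (\<Sum>i=1..K. (k i)\<^sup>2 * \<theta> i) (\<Sum>i=1..K. (k i)\<^sup>2 * \<tau> i) Y
    \<and> 0 < (\<Sum>i=1..K. (k i)\<^sup>2 * \<theta> i)
    \<and> ereal (\<Sum>i=1..K. (k i)\<^sup>2 * \<tau> i) \<le> ereal (\<Sum>i=1..K. (k i)\<^sup>2 * \<theta> i) / \<Delta>"
proof -
  interpret prob_space M by fact
  define T where "T = time_set \<Delta>"
  define I where "I = {1..K}"
  define \<Theta> where "\<Theta> = (\<Sum>i\<in>I. (k i)\<^sup>2 * \<theta> i)"
  define \<Upsilon> where "\<Upsilon> = (\<Sum>i\<in>I. (k i)\<^sup>2 * \<tau> i)"
  note X = assms(6)[unfolded gmsi_process_def, folded T_def I_def]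
  have Xc: "gmsi_covariance M \<Delta> (\<theta> i) (\<tau> i) (X i)" if "i \<in> I" for i
    using X[OF that] prob_space_axioms
    by (simp add: gmsi_covariance_def gmsi_covariance_axioms_def T_def)
  note meas = gmsi_covariance.random_variable_X[OF Xc, folded T_def]
  note integrable = gmsi_covariance.integrable_X[OF Xc, folded T_def]
  note gauss = gmsi_covariance.gaussian[OF Xc, folded T_def]
  note mean = gmsi_covariance.mean[OF Xc, folded T_def]
  note cov = gmsi_covariance.cov[OF Xc, folded T_def]
  have finI: "finite I" by (simp add: I_def)
  have Y: "Y t \<omega> = (\<Sum>i\<in>I. k i * X i t \<omega>)" if "t \<in> T" "\<omega> \<in> space M" for t \<omega>
    using assms(9) that by (simp add: T_def I_def)
  have indep: "indep_vars (\<lambda>_. Pi\<^sub>M T (\<lambda>_. borel)) (\<lambda>i \<omega>. \<lambda>t\<in>T. X i t \<omega>) I"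
    using assms(7) by (simp add: indep_processes_def T_def I_def)

  have \<Theta>_pos: "0 < \<Theta>"
  proof -
    obtain j where j: "j \<in> I" "k j \<noteq> 0" using assms(8) by (auto simp: I_def)
    have \<theta>: "0 < \<theta> i" if "i \<in> I" for i using assms(2) that by (simp add: I_def)
    show ?thesis unfolding \<Theta>_def
    proof (rule sum_pos2[OF finI j(1)])
      show "0 < (k j)\<^sup>2 * \<theta> j" using j \<theta> by simp
      show "0 \<le> (k i)\<^sup>2 * \<theta> i" if "i \<in> I" for i using \<theta>[OF that] by simp
    qed
  qed
  have \<Upsilon>_le: "ereal \<Upsilon> \<le> ereal \<Theta> / \<Delta>"
  \<comment> \<open>The bound on each \<open>\<tau> i\<close> contained in
    \<open>gmsi_process\<close> is summed with the nonnegative weights \<open>(k i)\<^sup>2\<close>;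
    for infinite \<Delta> it reads \<open>\<tau> i \<le> 0\<close>.\<close>
  proof (cases \<Delta>)
    case (real d)
    with assms(4) have "0 < d" by simp
    have "\<Upsilon> \<le> (\<Sum>i\<in>I. (k i)\<^sup>2 * (\<theta> i / d))"
      unfolding \<Upsilon>_def using X real \<open>0 < d\<close> by (intro sum_mono mult_left_mono) auto
    also have "\<dots> = \<Theta> / d" by (simp add: \<Theta>_def sum_divide_distrib)
    finally show ?thesis using real \<open>0 < d\<close> by simp
  next
    case PInf
    then have "\<Upsilon> \<le> 0" unfolding \<Upsilon>_def using X by (intro sum_nonpos mult_nonneg_nonpos) auto
    then show ?thesis using PInf by simp
  qed (use assms(4) in auto)

  have meas_Y: "Y t \<in> borel_measurable M" if "t \<in> T" for t
  proof -
    have "(\<lambda>\<omega>. \<Sum>i\<in>I. k i * X i t \<omega>) \<in> borel_measurable M"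
      using meas that by (intro borel_measurable_sum borel_measurable_times) auto
    then show ?thesis using Y[OF that] by (simp cong: measurable_cong)
  qed

  have gaussian_Y: "gaussian_process M T Y"
    unfolding gaussian_process_def
  proof (intro allI impI, elim conjE)
    fix S and c :: "real \<Rightarrow> real" assume S: "finite S" "S \<subseteq> T"
    \<comment> \<open>The combination of values of \<open>Y\<close> is regrouped by component. Each
      \<open>L i\<close> is a measurable function of the path of \<open>X i\<close> alone, so the
      \<open>L i\<close> inherit independence.\<close>
    define L where "L i \<omega> = (\<Sum>t\<in>S. (k i * c t) * X i t \<omega>)" for i \<omega>
    have "indep_vars (\<lambda>_. borel) (\<lambda>i \<omega>. \<Sum>t\<in>S. (k i * c t) * (\<lambda>t\<in>T. X i t \<omega>) t) I"
      by (rule indep_vars_compose2[OF indep, where Y="\<lambda>i f. \<Sum>t\<in>S. (k i * c t) * f t"])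
        (use S in \<open>auto intro!: borel_measurable_sum borel_measurable_times measurable_component_singleton\<close>)
    moreover have "(\<Sum>t\<in>S. (k i * c t) * (\<lambda>t\<in>T. X i t \<omega>) t) = L i \<omega>" for i \<omega>
      unfolding L_def using S by (intro sum.cong) auto
    ultimately have "indep_vars (\<lambda>_. borel) L I" by simp
    moreover have "gaussian_rv M (L i)" if "i \<in> I" for i
      unfolding L_def[abs_def]
      by (rule gauss[OF that, unfolded gaussian_process_def, rule_format, OF conjI[OF S]])
    moreover have "expectation (L i) = 0" if "i \<in> I" for i
    proof -
      have "expectation (L i) = (\<Sum>t\<in>S. (k i * c t) * expectation (X i t))"
        unfolding L_def[abs_def] using integrable[OF that] S
        by (subst Bochner_Integration.integral_sum) auto
      also have "\<dots> = 0" using mean[OF that] S by (intro sum.neutral) auto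
      finally show ?thesis .
    qed
    ultimately have "gaussian_rv M (\<lambda>\<omega>. \<Sum>i\<in>I. L i \<omega>)"
      by (rule gaussian_rv_indep_sum[OF finI])
    moreover have "(\<Sum>t\<in>S. c t * Y t \<omega>) = (\<Sum>i\<in>I. L i \<omega>)" if "\<omega> \<in> space M" for \<omega>
    proof -
      have "(\<Sum>t\<in>S. c t * Y t \<omega>) = (\<Sum>t\<in>S. \<Sum>i\<in>I. (k i * c t) * X i t \<omega>)"
        using S Y[OF _ that] by (intro sum.cong) (auto simp: sum_distrib_left mult_ac)
      then show ?thesis unfolding L_def by (subst sum.swap) 
    qed
    ultimately show "gaussian_rv M (\<lambda>\<omega>. \<Sum>t\<in>S. c t * Y t \<omega>)"
      by (simp cong: gaussian_rv_cong)
  qed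

  have mean_Y: "expectation (Y t) = 0" if t: "t \<in> T" for t
  proof -
    have "expectation (Y t) = expectation (\<lambda>\<omega>. \<Sum>i\<in>I. k i * X i t \<omega>)"
      by (intro Bochner_Integration.integral_cong) (auto simp: Y[OF t])
    also have "\<dots> = (\<Sum>i\<in>I. k i * expectation (X i t))"
      using integrable t by (subst Bochner_Integration.integral_sum) auto
    also have "\<dots> = 0" using mean t by simp
    finally show ?thesis .
  qed

  have cov_Y: "expectation (\<lambda>\<omega>. Y s \<omega> * Y t \<omega>) = s * (\<Theta> - \<Upsilon> * t)"
    if s: "s \<in> T" and t: "t \<in> T" and st: "s \<le> t" for s t
  proof -
    have cross: "integrable M (\<lambda>\<omega>. X i s \<omega> * X j t \<omega>)"
      "expectation (\<lambda>\<omega>. X i s \<omega> * X j t \<omega>) = (if i = j then s * (\<theta> i - \<tau> i * t) else 0)"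
      if i: "i \<in> I" and j: "j \<in> I" for i j
    proof -
      have "integrable M (\<lambda>\<omega>. X i s \<omega> * X j t \<omega>)
        \<and> expectation (\<lambda>\<omega>. X i s \<omega> * X j t \<omega>) = (if i = j then s * (\<theta> i - \<tau> i * t) else 0)"
      proof (cases "i = j")
        case True
        then show ?thesis
          using gmsi_covariance.integrable_X_mult[OF Xc[OF i], folded T_def, OF s t]
            cov[OF i s t st] by simp
      next
        case False
        \<comment> \<open>One time is selected per component, \<open>s\<close> for \<open>i\<close>
          and \<open>t\<close> for every other index. The evaluations \<open>X l (u l)\<close> then
          form one independent family containing both \<open>X i s\<close> and \<open>X j t\<close>,
          and the product moment factors into zero means.\<close>
        define u where "u l = (if l = i then s else t)" for l
        have u: "u l \<in> T" for l using s t by (simp add: u_def)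
        have "indep_vars (\<lambda>_. borel) (\<lambda>l \<omega>. (\<lambda>t\<in>T. X l t \<omega>) (u l)) I"
          by (rule indep_vars_compose2[OF indep, where Y="\<lambda>l f. f (u l)"])
            (use u in \<open>auto intro!: measurable_component_singleton\<close>)
        then have "indep_vars (\<lambda>_. borel) (\<lambda>l \<omega>. X l (u l) \<omega>) I" using u by simp
        then have ind: "indep_vars (\<lambda>_. borel) (\<lambda>l \<omega>. X l (u l) \<omega>) {i, j}"
          by (rule indep_vars_subset) (use i j in auto)
        have int: "integrable M (X l (u l))" if "l \<in> {i, j}" for l
          using that i j u integrable by auto
        show ?thesis
          using indep_vars_integrable[OF _ ind int] indep_vars_lebesgue_integral[OF _ ind int]
            False mean[OF i s] mean[OF j t] by (simp add: u_def)
      qed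
      then show "integrable M (\<lambda>\<omega>. X i s \<omega> * X j t \<omega>)"
        "expectation (\<lambda>\<omega>. X i s \<omega> * X j t \<omega>) = (if i = j then s * (\<theta> i - \<tau> i * t) else 0)" by auto
    qed
    have "expectation (\<lambda>\<omega>. Y s \<omega> * Y t \<omega>)
        = expectation (\<lambda>\<omega>. \<Sum>i\<in>I. \<Sum>j\<in>I. (k i * k j) * (X i s \<omega> * X j t \<omega>))"
      by (intro Bochner_Integration.integral_cong) (auto simp: Y[OF s] Y[OF t] sum_product mult_ac)
    also have "\<dots> = (\<Sum>i\<in>I. \<Sum>j\<in>I. (k i * k j) * expectation (\<lambda>\<omega>. X i s \<omega> * X j t \<omega>))"
      using cross(1) by simp
    also have "\<dots> = (\<Sum>i\<in>I. \<Sum>j\<in>I. if j = i then (k i)\<^sup>2 * (s * (\<theta> i - \<tau> i * t)) else 0)"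
      using cross(2) by (intro sum.cong) (auto simp: power2_eq_square)
    also have "\<dots> = (\<Sum>i\<in>I. (k i)\<^sup>2 * (s * (\<theta> i - \<tau> i * t)))"
      using finI by simp
    also have "\<dots> = s * (\<Theta> - \<Upsilon> * t)"
      by (simp add: \<Theta>_def \<Upsilon>_def sum_distrib_left sum_distrib_right algebra_simps flip: sum_subtractf)
    finally show ?thesis .
  qed

  have "0 \<in> T" using assms(4) by (simp add: T_def time_set_def zero_ereal_def)
  \<comment> \<open>With finitely many components the exceptional null sets can be merged;
    \<open>AE_space\<close> then restricts to points where \<open>Y\<close> is the sum. The same is
    done for continuity below.\<close>
  have "AE \<omega> in M. \<forall>i\<in>I. X i 0 \<omega> = 0"
    using X finI by (intro AE_finite_allI) auto
  then have zero_Y: "AE \<omega> in M. Y 0 \<omega> = 0"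
    using AE_space by eventually_elim (simp add: Y \<open>0 \<in> T\<close>)
  have "AE \<omega> in M. \<forall>i\<in>I. continuous_on T (\<lambda>t. X i t \<omega>)"
    using X finI by (intro AE_finite_allI) auto
  then have cont_Y: "AE \<omega> in M. continuous_on T (\<lambda>t. Y t \<omega>)"
    using AE_space
  proof eventually_elim
    case (elim \<omega>)
    then have "continuous_on T (\<lambda>t. \<Sum>i\<in>I. k i * X i t \<omega>)" by (intro continuous_intros) auto
    then show ?case using elim(2) by (simp add: Y cong: continuous_on_cong)
  qed

  \<comment> \<open>The Markov property is not inherited by sums in general. Here it is derived
    afresh from the covariance of \<open>Y\<close>, which again has GMSI form.\<close>
  interpret Y: gmsi_covariance M \<Delta> \<Theta> \<Upsilon> Y
    by unfold_locales (use \<Theta>_pos \<Upsilon>_le gaussian_Y mean_Y cov_Y in \<open>auto simp: T_def\<close>)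
  have "gmsi_process M \<Delta> \<Theta> \<Upsilon> Y"
    unfolding gmsi_process_def
    using prob_space_axioms assms(4) \<Theta>_pos \<Upsilon>_le cont_Y zero_Y gaussian_Y mean_Y cov_Y
      Y.markov Y.stationary by (simp add: T_def)
  then show ?thesis using \<Theta>_pos \<Upsilon>_le unfolding \<Theta>_def \<Upsilon>_def I_def by blast
qed

end
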